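(* Let $(X,\|\cdot\|)$ be a Banach space, $J:X\to X$ a nonexpansive mapping and $A=I-J$. Let $U_0\in X$ and let $U:[0,+\infty)\to X$ be the solution of $U'(t)=J(U(t))-U(t)$ with $U(0)=U_0$. Then for every $t\ge 0$ and every integer $m\ge 1$ with $m\geq t$, $$\left\|U_t^m(U_0)-U(t)\right\|\leq \|A(U_0)\|\,\frac{t}{\sqrt{m}},\qquad\text{where } U_t^m(x)=\left(I-\frac{t}{m}A\right)^m(x).$$ In particular, for any $t\geq 0$, the following strong (norm) convergence holds: $$\lim_{m\to+\infty}\left(I-\frac{t}{m}A\right)^m(U_0)=U(t).$$
   Context: $J$ nonexpansive means $\|J(x)-J(y)\|\le\|x-y\|$ for all $x,y\in X$. $I$ is the identity of $X$, and $(I-\frac tm A)^m$ denotes the $m$-fold composition of the (nonlinear) map $x\mapsto x-\frac tm A(x)$. The solution $U$ exists, is unique and is $\mathcal C^1$ on $[0,+\infty)$ by the Cauchy-Lipschitz theorem. *)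

theory Defs
  imports "HOL-Analysis.Analysis"
begin

definition nonexpansive :: "('a::real_normed_vector \<Rightarrow> 'a) \<Rightarrow> bool" where
  "nonexpansive J \<longleftrightarrow> (\<forall>x y. norm (J x - J y) \<le> norm (x - y))"

text \<open>
  The map \<open>U\<^sub>t\<^sup>m = (I - (t/m) A)\<^sup>m\<close>, an \<open>m\<close>-fold composition; it is only meaningful for \<open>m \<ge> 1\<close>.
\<close>
definition euler_iterate :: "('a::real_normed_vector \<Rightarrow> 'a) \<Rightarrow> real \<Rightarrow> nat \<Rightarrow> 'a \<Rightarrow> 'a" where
  "euler_iterate A t m = (\<lambda>x. x - (t / real m) *\<^sub>R A x) ^^ m"

end

theory Submission
  imports Defs
begin

text \<open>
  Put \<open>h = t / m\<close>, which lies in \<open>[0, 1]\<close>. The map \<open>K = I - h A = (1 - h) I + h J\<close> is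
  nonexpansive, and \<open>V(s) = U(h s)\<close> solves \<open>V' = K V - V\<close>. Since \<open>I - K = h A\<close>, the estimate
  reduces to step size one: for \<open>J\<close> nonexpansive and \<open>V' = J V - V\<close>, with \<open>x = V(0)\<close>,
  \<open>\<parallel>J\<^sup>n x - V(s)\<parallel> \<le> \<parallel>x - J x\<parallel> \<surd>(s + (n - s)\<^sup>2)\<close>
  (lemma \<open>iterate_flow_bound\<close>), to be used at \<open>n = s = m\<close>.

  That bound is proved by induction on \<open>n\<close>. The derivative of \<open>e\<^sup>s (y - V(s))\<close> is
  \<open>e\<^sup>s (y - J V(s))\<close>, so the mean value inequality gives a comparison principle (lemma
  \<open>flow_comparison\<close>): \<open>\<parallel>y - V(s)\<parallel>\<close> stays below any \<open>g\<close> that dominates it at \<open>0\<close> and satisfies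
  \<open>\<parallel>y - J V\<parallel> \<le> g + g'\<close>. With \<open>y = J\<^sup>n x\<close>, \<open>n \<ge> 1\<close>, the left-hand side is at most
  \<open>\<parallel>J\<^bsup>n-1\<^esup> x - V\<parallel>\<close>, and \<open>g\<^sub>n(s) = \<surd>(s + (n - s)\<^sup>2)\<close> satisfies \<open>g\<^bsub>n-1\<^esub> \<le> g\<^sub>n + g\<^sub>n'\<close>, because
  \<open>g\<^sub>n (g\<^sub>n + g\<^sub>n') = (g\<^sub>n\<^sup>2 + g\<^bsub>n-1\<^esub>\<^sup>2) / 2\<close>. The case \<open>n = 0\<close> is the bound
  \<open>\<parallel>x - V(s)\<parallel> \<le> \<parallel>x - J x\<parallel> s\<close> (lemma \<open>flow_displacement_bound\<close>).
\<close>

lemma nonexpansiveD: "nonexpansive J \<Longrightarrow> norm (J x - J y) \<le> norm (x - y)"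
  by (simp add: nonexpansive_def)

lemma continuous_on_trajectory:
  fixes V :: "real \<Rightarrow> 'a::real_normed_vector"
  assumes V: "\<And>r. r \<ge> 0 \<Longrightarrow> (V has_vector_derivative V' r) (at r within {0..})"
  shows "continuous_on {0..s} V"
  unfolding continuous_on_eq_continuous_within
proof
  fix r assume "r \<in> {0..s}"
  then show "continuous (at r within {0..s}) V"
    by (intro continuous_within_subset[OF has_vector_derivative_continuous[OF V]]) auto
qed

text \<open>
  The last term keeps track of the initial gap \<open>\<parallel>y - V(0)\<parallel> - g(0)\<close>, which may be negative.
\<close>
lemma flow_comparison:
  fixes V :: "real \<Rightarrow> 'a::real_normed_vector" and g g' :: "real \<Rightarrow> real"
  assumes V: "\<And>r. r \<ge> 0 \<Longrightarrow> (V has_vector_derivative (J (V r) - V r)) (at r within {0..})"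
    and s: "s \<ge> 0"
    and g_cont: "continuous_on {0..s} g"
    and g_deriv: "\<And>r. 0 < r \<Longrightarrow> r < s \<Longrightarrow> (g has_real_derivative g' r) (at r)"
    and bound: "\<And>r. 0 < r \<Longrightarrow> r < s \<Longrightarrow> norm (y - J (V r)) \<le> g r + g' r"
  shows "norm (y - V s) \<le> g s + exp (- s) * (norm (y - V 0) - g 0)"
proof (cases "s = 0")
  case True
  then show ?thesis by simp
next
  case False
  with s have s: "0 < s" by simp
  have V_at: "(V has_vector_derivative (J (V r) - V r)) (at r)" if "0 < r" for r
  proof -
    have "at r within {0..} = at r"
      using that by (intro at_within_interior) simp
    with V[of r] that show ?thesis
      by simp
  qed
  have V_cont: "continuous_on {0..s} V"
    by (rule continuous_on_trajectory[OF V])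
  have "norm (exp s *\<^sub>R (y - V s) - exp 0 *\<^sub>R (y - V 0)) \<le> exp s * g s - exp 0 * g 0"
  proof (rule differentiable_bound_general[OF s,
        where f' = "\<lambda>r. exp r *\<^sub>R (y - J (V r))" and \<phi>' = "\<lambda>r. exp r * (g r + g' r)"])
    show "continuous_on {0..s} (\<lambda>r. exp r *\<^sub>R (y - V r))"
      by (intro continuous_intros V_cont)
    show "continuous_on {0..s} (\<lambda>r. exp r * g r)"
      by (intro continuous_intros g_cont)
    fix r assume r: "0 < r" "r < s"
    show "((\<lambda>r. exp r *\<^sub>R (y - V r)) has_vector_derivative exp r *\<^sub>R (y - J (V r))) (at r)"
      using has_vector_derivative_scaleR[OF DERIV_exp
          has_vector_derivative_diff[OF has_vector_derivative_const V_at[OF r(1)]], of y]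
      by (simp add: algebra_simps)
    show "((\<lambda>r. exp r * g r) has_vector_derivative exp r * (g r + g' r)) (at r)"
      unfolding has_real_derivative_iff_has_vector_derivative[symmetric]
      by (auto intro!: derivative_eq_intros g_deriv[OF r] simp: algebra_simps)
    show "norm (exp r *\<^sub>R (y - J (V r))) \<le> exp r * (g r + g' r)"
      using bound[OF r] by simp
  qed
  then have "exp s * norm (y - V s) \<le> exp s * g s - g 0 + norm (y - V 0)"
    using norm_triangle_ineq2[of "exp s *\<^sub>R (y - V s)" "y - V 0"] by simp
  then show ?thesis
    by (simp add: exp_minus field_simps)
qed

text \<open>
  With \<open>C = \<parallel>V(0) - J(V(0))\<parallel>\<close>, let \<open>M\<close> be the maximum on \<open>[0, s]\<close> of the excess
  \<open>\<parallel>V(0) - V(r)\<parallel> - C r\<close>, attained at \<open>p\<close>. Comparison with \<open>C r + M\<close>, which exceeds the left-hand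
  side by \<open>M\<close> at \<open>0\<close>, gains \<open>e\<^bsup>-p\<^esup> M\<close> at \<open>p\<close>, so \<open>M \<le> M - e\<^bsup>-p\<^esup> M\<close> if \<open>M > 0\<close>, a contradiction.
\<close>
lemma flow_displacement_bound:
  fixes V :: "real \<Rightarrow> 'a::real_normed_vector"
  assumes J: "nonexpansive J"
    and V: "\<And>r. r \<ge> 0 \<Longrightarrow> (V has_vector_derivative (J (V r) - V r)) (at r within {0..})"
    and s: "s \<ge> 0"
  shows "norm (V 0 - V s) \<le> norm (V 0 - J (V 0)) * s"
proof -
  define C where "C = norm (V 0 - J (V 0))"
  define e where "e r = norm (V 0 - V r) - C * r" for r
  have "continuous_on {0..s} V"
    by (rule continuous_on_trajectory[OF V])
  then have "continuous_on {0..s} e"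
    unfolding e_def by (intro continuous_intros)
  then obtain p where p: "p \<in> {0..s}" and max: "\<And>r. r \<in> {0..s} \<Longrightarrow> e r \<le> e p"
    using continuous_attains_sup[of "{0..s}" e] s by auto
  have "e p \<le> 0"
  proof (rule ccontr)
    assume "\<not> e p \<le> 0"
    moreover have "e 0 = 0"
      by (simp add: e_def)
    ultimately have pos: "0 < e p" "0 < p"
      using p by (auto simp: less_le)
    have "norm (V 0 - V p) \<le> (C * p + e p) + exp (- p) * (norm (V 0 - V 0) - (C * 0 + e p))"
    proof (rule flow_comparison[OF V, where g = "\<lambda>r. C * r + e p" and g' = "\<lambda>_. C"])
      fix r assume r: "0 < r" "r < p"
      have "norm (V 0 - J (V r)) \<le> C + norm (J (V 0) - J (V r))"
        using norm_triangle_ineq[of "V 0 - J (V 0)" "J (V 0) - J (V r)"] by (simp add: C_def)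
      also have "\<dots> \<le> C + norm (V 0 - V r)"
        using nonexpansiveD[OF J] by simp
      also have "\<dots> \<le> (C * r + e p) + C"
        using max[of r] r p by (simp add: e_def)
      finally show "norm (V 0 - J (V r)) \<le> (C * r + e p) + C" .
    next
      show "continuous_on {0..p} (\<lambda>r. C * r + e p)"
        by (intro continuous_intros)
      show "((\<lambda>r. C * r + e p) has_real_derivative C) (at r)" for r
        by (auto intro!: derivative_eq_intros)
      show "0 \<le> p"
        using p by simp
    qed
    moreover have "norm (V 0 - V p) = C * p + e p"
      by (simp add: e_def)
    ultimately have "exp (- p) * e p \<le> 0"
      by simp
    with pos(1) show False
      by (simp add: mult_le_0_iff)
  qed
  with max[of s] s show ?thesis
    by (simp add: e_def C_def)
qed

lemma nonexpansive_funpow_displacement: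
  assumes J: "nonexpansive J"
  shows "norm ((J ^^ n) x - x) \<le> norm (x - J x) * real n"
proof (induction n)
  case 0
  then show ?case by simp
next
  case (Suc n)
  have "norm ((J ^^ Suc n) x - x) \<le> norm (J ((J ^^ n) x) - J x) + norm (J x - x)"
    using norm_triangle_ineq[of "J ((J ^^ n) x) - J x" "J x - x"] by simp
  also have "\<dots> \<le> norm ((J ^^ n) x - x) + norm (x - J x)"
    using nonexpansiveD[OF J] by (simp add: norm_minus_commute)
  finally show ?case
    using Suc by (simp add: algebra_simps)
qed

lemma iterate_flow_bound:
  fixes V :: "real \<Rightarrow> 'a::real_normed_vector"
  assumes J: "nonexpansive J"
    and V: "\<And>r. r \<ge> 0 \<Longrightarrow> (V has_vector_derivative (J (V r) - V r)) (at r within {0..})"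
    and s: "s \<ge> 0"
  shows "norm ((J ^^ n) (V 0) - V s) \<le> norm (V 0 - J (V 0)) * sqrt (s + (real n - s)\<^sup>2)"
  using s
proof (induction n arbitrary: s)
  case 0
  have "s \<le> sqrt (s + s\<^sup>2)"
    using 0 by (intro real_le_rsqrt) simp
  then have "norm (V 0 - J (V 0)) * s \<le> norm (V 0 - J (V 0)) * sqrt (s + s\<^sup>2)"
    by (intro mult_left_mono) auto
  with flow_displacement_bound[OF J V 0] show ?case
    by simp
next
  case (Suc n)
  define C where "C = norm (V 0 - J (V 0))"
  define q where "q k r = r + (real k - r)\<^sup>2" for k :: nat and r :: real
  define g' where "g' r = C * ((1 - 2 * (real (Suc n) - r)) / (2 * sqrt (q (Suc n) r)))" for r
  have q_pos: "0 < q (Suc n) r" if "0 < r" for r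
    using that by (simp add: q_def add_pos_nonneg)
  have "norm ((J ^^ Suc n) (V 0) - V s) \<le> C * sqrt (q (Suc n) s)
      + exp (- s) * (norm ((J ^^ Suc n) (V 0) - V 0) - C * sqrt (q (Suc n) 0))"
  proof (rule flow_comparison[OF V Suc.prems,
        where g = "\<lambda>r. C * sqrt (q (Suc n) r)" and g' = g'])
    show "continuous_on {0..s} (\<lambda>r. C * sqrt (q (Suc n) r))"
      unfolding q_def by (intro continuous_intros)
    fix r :: real assume r: "0 < r" "r < s"
    have qp: "0 < r + (real (Suc n) - r)\<^sup>2"
      using q_pos[OF r(1)] by (simp only: q_def)
    show "((\<lambda>r. C * sqrt (q (Suc n) r)) has_real_derivative g' r) (at r)"
    proof -
      have "((\<lambda>r. r + (real (Suc n) - r)\<^sup>2) has_real_derivative 1 - 2 * (real (Suc n) - r)) (at r)"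
        by (auto intro!: derivative_eq_intros)
      from DERIV_cmult[OF DERIV_chain2[OF DERIV_real_sqrt[OF qp] this], of C] show ?thesis
        unfolding g'_def q_def by (simp add: field_simps)
    qed
    let ?a = "sqrt (q (Suc n) r)" and ?b = "sqrt (q n r)"
    have a: "0 < ?a" "?a\<^sup>2 = q (Suc n) r"
      using q_pos[OF r(1)] by auto
    have b: "?b\<^sup>2 = q n r"
      using r by (simp add: q_def)
    have diff: "1 - 2 * (real (Suc n) - r) = ?b\<^sup>2 - ?a\<^sup>2"
      unfolding a(2) b by (simp add: q_def power2_eq_square algebra_simps)
    \<comment> \<open>This is \<open>2 g\<^sub>n g\<^bsub>n+1\<^esub> \<le> g\<^sub>n\<^sup>2 + g\<^bsub>n+1\<^esub>\<^sup>2\<close> divided by \<open>2 g\<^bsub>n+1\<^esub>\<close>.\<close>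
    have "?b \<le> ?a + (?b\<^sup>2 - ?a\<^sup>2) / (2 * ?a)"
    proof -
      have "?a + (?b\<^sup>2 - ?a\<^sup>2) / (2 * ?a) - ?b = (?a - ?b)\<^sup>2 / (2 * ?a)"
        using a(1) by (simp add: power2_eq_square field_simps del: real_sqrt_mult_self real_sqrt_mult)
      moreover have "0 \<le> (?a - ?b)\<^sup>2 / (2 * ?a)"
        using a(1) by simp
      ultimately show ?thesis by linarith
    qed
    then have ab: "C * ?b \<le> C * ?a + g' r"
      unfolding g'_def diff distrib_left[symmetric] by (intro mult_left_mono) (auto simp: C_def)
    have "norm ((J ^^ Suc n) (V 0) - J (V r)) \<le> norm ((J ^^ n) (V 0) - V r)"
      using nonexpansiveD[OF J] by simp
    also have "\<dots> \<le> C * ?b"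
      using Suc.IH[of r] r by (simp add: C_def q_def)
    also note ab
    finally show "norm ((J ^^ Suc n) (V 0) - J (V r)) \<le> C * ?a + g' r" .
  qed
  moreover have "norm ((J ^^ Suc n) (V 0) - V 0) - C * sqrt (q (Suc n) 0) \<le> 0"
    using nonexpansive_funpow_displacement[OF J, of "Suc n" "V 0"]
    by (simp add: C_def q_def del: funpow.simps)
  then have "exp (- s) * (norm ((J ^^ Suc n) (V 0) - V 0) - C * sqrt (q (Suc n) 0)) \<le> 0"
    by (simp add: mult_le_0_iff)
  ultimately show ?case
    unfolding C_def q_def by linarith
qed

lemma nonexpansive_relaxation:
  fixes J :: "'a::real_normed_vector \<Rightarrow> 'a"
  assumes J: "nonexpansive J" and h: "0 \<le> h" "h \<le> 1"
  shows "nonexpansive (\<lambda>x. x - h *\<^sub>R (x - J x))"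
  unfolding nonexpansive_def
proof (intro allI)
  fix x y :: 'a
  have "(x - h *\<^sub>R (x - J x)) - (y - h *\<^sub>R (y - J y)) = (1 - h) *\<^sub>R (x - y) + h *\<^sub>R (J x - J y)"
    by (simp add: algebra_simps)
  also have "norm \<dots> \<le> (1 - h) * norm (x - y) + h * norm (J x - J y)"
    using norm_triangle_ineq[of "(1 - h) *\<^sub>R (x - y)" "h *\<^sub>R (J x - J y)"] h by simp
  also have "\<dots> \<le> (1 - h) * norm (x - y) + h * norm (x - y)"
    using nonexpansiveD[OF J] h by (intro add_left_mono mult_left_mono) auto
  finally show "norm ((x - h *\<^sub>R (x - J x)) - (y - h *\<^sub>R (y - J y))) \<le> norm (x - y)"
    by (simp add: algebra_simps)
qed

lemma euler_iterate_error:
  fixes U :: "real \<Rightarrow> 'a::real_normed_vector"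
  assumes J: "nonexpansive J"
    and A: "A = (\<lambda>x. x - J x)"
    and U: "\<And>r. r \<ge> 0 \<Longrightarrow> (U has_vector_derivative (J (U r) - U r)) (at r within {0..})"
    and t: "0 \<le> t" and m: "m \<ge> 1" "t \<le> real m"
  shows "norm (euler_iterate A t m (U 0) - U t) \<le> norm (A (U 0)) * (t / sqrt (real m))"
proof -
  define h where "h = t / real m"
  define K where "K = (\<lambda>x. x - h *\<^sub>R A x)"
  have h: "0 \<le> h" "h \<le> 1" and hm: "h * real m = t"
    using t m by (auto simp: h_def)
  have K: "nonexpansive K"
    unfolding K_def A by (rule nonexpansive_relaxation[OF J h])
  have V: "((\<lambda>r. U (h * r)) has_vector_derivative (K (U (h * r)) - U (h * r))) (at r within {0..})"
    if "r \<ge> 0" for r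
  proof -
    have "((\<lambda>r. h * r) has_vector_derivative h) (at r within {0..})"
      by (auto intro!: derivative_eq_intros)
    moreover have "(U has_vector_derivative (J (U (h * r)) - U (h * r)))
        (at (h * r) within (\<lambda>r. h * r) ` {0..})"
      using h that by (intro has_vector_derivative_within_subset[OF U]) auto
    ultimately have "(U \<circ> (\<lambda>r. h * r) has_vector_derivative
        h *\<^sub>R (J (U (h * r)) - U (h * r))) (at r within {0..})"
      by (rule vector_diff_chain_within)
    then show ?thesis
      by (simp add: o_def K_def A algebra_simps)
  qed
  have "norm ((K ^^ m) (U 0) - U t) \<le> norm (U 0 - K (U 0)) * sqrt (real m)"
    using iterate_flow_bound[OF K V, of "real m" m] by (simp add: hm)
  also have "norm (U 0 - K (U 0)) = h * norm (A (U 0))"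
    using h by (simp add: K_def)
  also have "h * norm (A (U 0)) * sqrt (real m) = norm (A (U 0)) * (t / sqrt (real m))"
    using m by (simp add: h_def real_div_sqrt field_simps)
  finally show ?thesis
    by (simp add: euler_iterate_def K_def h_def)
qed

theorem proposition3p10:
  fixes J A :: "'a::banach \<Rightarrow> 'a" and U :: "real \<Rightarrow> 'a" and U0 :: 'a
  assumes "nonexpansive J"
    and "A = (\<lambda>x. x - J x)"
    and "\<And>t. t \<ge> 0 \<Longrightarrow> (U has_vector_derivative (J (U t) - U t)) (at t within {0..})"
    and "U 0 = U0"
  shows "(\<forall>t\<ge>0. \<forall>m::nat. m \<ge> 1 \<and> real m \<ge> t \<longrightarrow>
            norm (euler_iterate A t m U0 - U t) \<le> norm (A U0) * (t / sqrt (real m)))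
       \<and> (\<forall>t\<ge>0. (\<lambda>m. euler_iterate A t m U0) \<longlonglongrightarrow> U t)"
proof -
  have error: "norm (euler_iterate A t m U0 - U t) \<le> norm (A U0) * (t / sqrt (real m))"
    if "t \<ge> 0" "m \<ge> 1" "real m \<ge> t" for t and m :: nat
    using euler_iterate_error[OF assms(1-3) that] assms(4) by simp
  have "(\<lambda>m. euler_iterate A t m U0) \<longlonglongrightarrow> U t" if t: "t \<ge> 0" for t
  proof -
    have "(\<lambda>m. norm (A U0) * (t / sqrt (real m))) \<longlonglongrightarrow> norm (A U0) * 0"
      by (intro tendsto_mult tendsto_const
          real_tendsto_divide_at_top[OF tendsto_const] filterlim_compose[OF sqrt_at_top] filterlim_real_sequentially)
    moreover have "\<forall>\<^sub>F m in sequentially.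
        norm (euler_iterate A t m U0 - U t) \<le> norm (A U0) * (t / sqrt (real m))"
      using eventually_ge_at_top[of "max 1 (nat \<lceil>t\<rceil>)"]
      by eventually_elim (rule error; use t in \<open>simp add: nat_le_iff ceiling_le_iff\<close>)
    ultimately have "(\<lambda>m. euler_iterate A t m U0 - U t) \<longlonglongrightarrow> 0"
      using Lim_null_comparison by force
    then show ?thesis
      by (simp add: LIM_zero_iff)
  qed
  with error show ?thesis by blast
qed

end
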